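(* Let $(K,\varrho)$ be a compact metric space, let $r>0$ be an integer, and let $f\colon [\mathbb{N}]^r\to K$ be an arbitrary function. Then there exists an infinite set $B\subseteq\mathbb{N}$ such that $f\restriction [B]^r$ converges to some element of $K$.
   Context: For a set $S$ and a positive integer $r$, $[S]^r$ denotes the set of all $r$-element subsets of $S$. For an infinite set $S\subseteq\mathbb{N}$ and a topological space $X$, a function $f\colon[S]^r\to X$ converges to $p\in X$ if for every neighborhood $U$ of $p$ there is a finite set $F$ such that $f(s)\in U$ for all $s\in[S\setminus F]^r$. *)

theory Defs
  imports "HOL-Analysis.Analysis" "HOL-Library.Ramsey"
begin

(* Only the values of f on [S]^r matter, so for a total f this is convergence of the
   restriction of f to [S]^r. As in limitin, neighbourhoods are taken open and the limit
   lies in the space. *)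
definition nsets_converges ::
    "'a topology \<Rightarrow> nat set \<Rightarrow> nat \<Rightarrow> (nat set \<Rightarrow> 'a) \<Rightarrow> 'a \<Rightarrow> bool"
  where "nsets_converges X S r f p \<longleftrightarrow>
    p \<in> topspace X \<and>
    (\<forall>U. openin X U \<and> p \<in> U \<longrightarrow>
       (\<exists>F. finite F \<and> (\<forall>s \<in> [S - F]\<^bsup>r\<^esup>. f s \<in> U)))"

end

theory Submission
  imports Defs
begin

text \<open>
  By total boundedness, \<open>K\<close> is covered by finitely many balls of any given radius, and colouring
  an \<open>r\<close>-set by a ball containing its value, Ramsey's theorem passes to an infinite set on whose
  \<open>r\<close>-subsets \<open>f\<close> stays in a single ball. Iterating with radii tending to \<open>0\<close> yields a decreasing
  sequence of infinite sets; \<open>B\<close> is a pseudo-intersection of it, and the limit is the common point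
  of the closures of the images of \<open>f\<close>, which exists by compactness.
\<close>

lemma (in Metric_space) Ramsey_mball:
  assumes "mtotally_bounded M" "infinite Z" "f \<in> [Z]\<^bsup>r\<^esup> \<rightarrow> M" "e > 0"
  obtains Y c where "Y \<subseteq> Z" "infinite Y" "f \<in> [Y]\<^bsup>r\<^esup> \<rightarrow> mball c e"
proof -
  obtain C where C: "finite C" "M \<subseteq> (\<Union>c\<in>C. mball c e)"
    using assms(1,4) unfolding mtotally_bounded_def by blast
  \<comment> \<open>Numbering the centres turns the choice of a ball into a colour in
    \<open>{..<n}\<close>, the form in which Ramsey's theorem is applied below.\<close>
  obtain h and n :: nat where h: "C = h ` {..<n}"
    using finite_imp_nat_seg_image_inj_on[OF C(1)] by (auto simp: lessThan_def)
  \<comment> \<open>The balls may overlap, so the least suitable index is taken to make the colour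
    well defined.\<close>
  define g where "g s = (LEAST i. i < n \<and> f s \<in> mball (h i) e)" for s
  have g: "g s < n \<and> f s \<in> mball (h (g s)) e" if "s \<in> [Z]\<^bsup>r\<^esup>" for s
  proof -
    have "f s \<in> M"
      using assms(3) that by blast
    then have "\<exists>i. i < n \<and> f s \<in> mball (h i) e"
      using C(2) h by blast
    then show ?thesis
      unfolding g_def by (rule LeastI_ex)
  qed
  then have "g ` [Z]\<^bsup>r\<^esup> \<subseteq> {..<n}"
    by auto
  then obtain Y t where Y: "Y \<subseteq> Z" "infinite Y" "g ` [Y]\<^bsup>r\<^esup> \<subseteq> {t}"
    using Ramsey_nsets[OF assms(2)] by metis
  have "f s \<in> mball (h t) e" if s: "s \<in> [Y]\<^bsup>r\<^esup>" for s
  proof -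
    have "g s = t" "s \<in> [Z]\<^bsup>r\<^esup>"
      using Y s nsets_mono by blast+
    then show ?thesis
      using g by blast
  qed
  then show thesis
    using that Y by blast
qed

text \<open>Diagonalisation: choose a strictly increasing sequence with \<open>b n\<close> in
  \<open>A n\<close>. Since \<open>A\<close> decreases, only the terms \<open>b i\<close> with
  \<open>i < n\<close> can miss \<open>A n\<close>.\<close>

lemma infinite_pseudo_intersection:
  fixes A :: "nat \<Rightarrow> nat set"
  assumes "decseq A" "\<And>n. infinite (A n)"
  obtains B where "infinite B" "\<And>n. finite (B - A n)"
proof -
  have *: "\<exists>b. b \<in> A n \<and> k < b" for n k
    using assms(2)[of n] by (auto simp: infinite_nat_iff_unbounded)
  have "\<exists>b. \<forall>n. b n \<in> A n \<and> b n < b (Suc n)"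
  proof (rule dependent_nat_choice)
    show "\<exists>b. b \<in> A 0"
      using *[of 0] by blast
    show "\<exists>b. b \<in> A (Suc n) \<and> k < b" for k n
      by (rule *)
  qed
  then obtain b where b: "\<And>n. b n \<in> A n" "\<And>n. b n < b (Suc n)"
    by blast
  then have "infinite (range b)"
    by (simp add: range_inj_infinite strict_mono_Suc_iff strict_mono_imp_inj_on)
  moreover have "finite (range b - A n)" for n
  proof (rule finite_subset)
    show "range b - A n \<subseteq> b ` {..<n}"
    proof
      fix x
      assume "x \<in> range b - A n"
      then obtain i where i: "x = b i" "b i \<notin> A n"
        by auto
      then have "i < n"
        using b(1)[of i] decseqD[OF assms(1), of n i] by (meson not_less subsetD)
      then show "x \<in> b ` {..<n}"
        using i by simp
    qed
  qed simp
  ultimately show thesis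
    using that by blast
qed

theorem theorem2p1:
  fixes K :: "'a set" and \<rho> :: "'a \<Rightarrow> 'a \<Rightarrow> real" and r :: nat and f :: "nat set \<Rightarrow> 'a"
  assumes "Metric_space K \<rho>"
    and "compact_space (Metric_space.mtopology K \<rho>)"
    and "r > 0"
    and "f \<in> [UNIV]\<^bsup>r\<^esup> \<rightarrow> K"
  shows "\<exists>B :: nat set. infinite B \<and>
    (\<exists>p \<in> K. nsets_converges (Metric_space.mtopology K \<rho>) B r f p)"
proof -
  interpret Metric_space K \<rho> by fact
  have tb: "mtotally_bounded K"
    using assms(2) compact_space_eq_mcomplete_mtotally_bounded by blast
  \<comment> \<open>Infinity of \<open>Y\<close> is part of the invariant so that Ramsey's theorem
    can be applied again inside \<open>Y\<close>; \<open>Suc n\<close> keeps the radius defined and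
    positive at \<open>n = 0\<close>.\<close>
  define small where
    "small Y n \<longleftrightarrow> infinite Y \<and> (\<exists>c. f \<in> [Y]\<^bsup>r\<^esup> \<rightarrow> mball c (inverse (Suc n)))" for Y n
  have step: "\<exists>Y. small Y n \<and> Y \<subseteq> Z" if Z: "infinite Z" for n and Z :: "nat set"
  proof -
    have "f \<in> [Z]\<^bsup>r\<^esup> \<rightarrow> K"
      using assms(4) nsets_Pi_contra[of Z UNIV] by blast
    then show ?thesis
      by (rule Ramsey_mball[OF tb Z, where e = "inverse (Suc n)"]) (auto simp: small_def)
  qed
  have "\<exists>A. \<forall>n. small (A n) n \<and> A (Suc n) \<subseteq> A n"
  proof (rule dependent_nat_choice)
    show "\<exists>Y. small Y 0"
      using step[of UNIV] by blast
    show "\<exists>Z. small Z (Suc n) \<and> Z \<subseteq> Y" if "small Y n" for Y n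
      using step that small_def by blast
  qed
  then obtain A where A: "\<And>n. small (A n) n" "\<And>n. A (Suc n) \<subseteq> A n"
    by blast
  have inf: "infinite (A n)" for n
    using A(1) by (simp add: small_def)
  have dec: "decseq A"
    using A(2) by (rule decseq_SucI)
  obtain B where B: "infinite B" "\<And>n. finite (B - A n)"
    using infinite_pseudo_intersection[OF dec inf] by blast
  \<comment> \<open>The images themselves are nested but need not be closed; the nested-set form of
    compactness applies to their closures.\<close>
  define C where "C n = mtopology closure_of (f ` [A n]\<^bsup>r\<^esup>)" for n
  have fK: "f ` [A n]\<^bsup>r\<^esup> \<subseteq> K" for n
    using assms(4) nsets_mono[of "A n" UNIV] by blast
  \<comment> \<open>An infinite set has \<open>r\<close>-element subsets, so the image is already
    nonempty.\<close>
  have "C n \<noteq> {}" for n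
    using inf[of n] fK[of n] nsets_eq_empty_iff[of "A n" r]
    by (simp add: C_def closure_of_eq_empty)
  moreover have "decseq C"
    unfolding C_def by (intro decseq_SucI closure_of_mono image_mono nsets_mono A(2))
  moreover have "closedin mtopology (C n)" for n
    by (simp add: C_def)
  ultimately have "(\<Inter>n. C n) \<noteq> {}"
    using compact_space_imp_nest[OF assms(2)] by blast
  then obtain p where p: "\<And>n. p \<in> C n"
    by blast
  have "p \<in> K"
    using p[of 0] in_closure_of[of p mtopology] by (simp add: C_def)
  have "\<exists>F. finite F \<and> (\<forall>s \<in> [B - F]\<^bsup>r\<^esup>. f s \<in> U)" if U: "openin mtopology U" "p \<in> U" for U
  proof -
    obtain e where e: "e > 0" "mball p e \<subseteq> U"
      using U openin_mtopology by blast
    \<comment> \<open>Half of \<open>e\<close> suffices: both \<open>p\<close> and the values of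
      \<open>f\<close> on \<open>r\<close>-subsets of \<open>A n\<close> lie within
      \<open>inverse (Suc n)\<close> of one centre \<open>c\<close>.\<close>
    obtain n where n: "inverse (Suc n) < e / 2"
      using reals_Archimedean[of "e / 2"] e(1) by auto
    obtain c where c: "f \<in> [A n]\<^bsup>r\<^esup> \<rightarrow> mball c (inverse (Suc n))"
      using A(1) small_def by blast
    \<comment> \<open>The closed ball is closed and contains the image, hence also its closure; this
      bounds the distance from \<open>c\<close> to \<open>p\<close>, with \<open>\<le>\<close> in
      place of \<open><\<close>.\<close>
    have "C n \<subseteq> mcball c (inverse (Suc n))"
      unfolding C_def using c mball_subset_mcball by (intro closure_of_minimal) (blast, simp)
    then have pc: "c \<in> K" "\<rho> c p \<le> inverse (Suc n)"
      using p[of n] by (auto simp: subset_iff)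
    \<comment> \<open>The finite exceptional set is \<open>B - A n\<close>: removing it from
      \<open>B\<close> leaves a subset of \<open>A n\<close>.\<close>
    have "f s \<in> U" if s: "s \<in> [B - (B - A n)]\<^bsup>r\<^esup>" for s
    proof -
      have "s \<in> [A n]\<^bsup>r\<^esup>"
        using s nsets_mono[of "B - (B - A n)" "A n"] by blast
      then have fs: "f s \<in> K" "\<rho> c (f s) < inverse (Suc n)"
        using c by (auto simp: Pi_iff)
      have "\<rho> p (f s) \<le> \<rho> c p + \<rho> c (f s)"
        using triangle[OF \<open>p \<in> K\<close> pc(1) fs(1)] commute by simp
      then have "\<rho> p (f s) < e"
        using pc(2) fs(2) n by linarith
      then show ?thesis
        using e(2) fs(1) \<open>p \<in> K\<close> by auto
    qed
    then show ?thesis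
      using B(2) by blast
  qed
  then show ?thesis
    using B(1) \<open>p \<in> K\<close> unfolding nsets_converges_def by auto
qed

end
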